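(* Let $\mathbf{x}, \mathbf{t}, \mathbf{y}, \mathbf{z}_1, \mathbf{z}_2$ be discrete random variables on a common probability space, where $\mathbf{x}, \mathbf{t}, \mathbf{y}$ have joint distribution $p(\mathbf{x},\mathbf{t},\mathbf{y})$. Assume that $\mathbf{z}_1$ is a sufficient representation of $\mathbf{x}$ with side-channel information $\mathbf{t}$ for $\mathbf{y}$, that is, $I(\mathbf{z}_1;\mathbf{y}\mid \mathbf{x}\mathbf{t})=0$ and $I(\mathbf{x}\mathbf{t};\mathbf{y}\mid \mathbf{z}_1)=0$. Assume also that $\mathbf{z}_2$ is a sufficient representation of $\mathbf{x}$ for $\mathbf{y}$, that is, $I(\mathbf{z}_2;\mathbf{y}\mid \mathbf{x})=0$ and $I(\mathbf{x};\mathbf{y}\mid \mathbf{z}_2)=0$. Then $$I(\mathbf{z}_1;\mathbf{y})\ \geq\ I(\mathbf{z}_2;\mathbf{y}).$$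
   Context: $I(\cdot\,;\cdot)$ denotes mutual information and $I(\cdot\,;\cdot\mid\cdot)$ denotes conditional mutual information. $\mathbf{x}\mathbf{t}$ denotes the joint random variable $(\mathbf{x},\mathbf{t})$. Here $\mathbf{x}$ stands for input features, $\mathbf{t}$ for side-channel information, and $\mathbf{y}$ for downstream labels. A random variable $\mathbf{z}_2$ is a representation of $\mathbf{x}$ if $I(\mathbf{z}_2;\mathbf{y}\mid\mathbf{x})=0$; it is sufficient for $\mathbf{y}$ if moreover $I(\mathbf{x};\mathbf{y}\mid\mathbf{z}_2)=0$. A random variable $\mathbf{z}_1$ is a representation of $\mathbf{x}$ with side-channel information $\mathbf{t}$ if $I(\mathbf{z}_1;\mathbf{y}\mid\mathbf{x}\mathbf{t})=0$; it is sufficient for $\mathbf{y}$ if moreover $I(\mathbf{x}\mathbf{t};\mathbf{y}\mid\mathbf{z}_1)=0$. *)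

theory Defs
  imports "HOL-Probability.Probability"
begin

text \<open>
  The library constants \<open>KL_divergence\<close> and \<open>mutual_information\<close> are real-valued Bochner integrals and
  hence equal to \<open>0\<close> when the divergence is infinite, which does happen for discrete variables with
  countably infinite range. The definitions below are the same notions with values in \<open>[0, \<infinity>]\<close>.
\<close>

definition discrete_rv :: "'w measure \<Rightarrow> ('w \<Rightarrow> 'a) \<Rightarrow> bool" where
  "discrete_rv M X \<longleftrightarrow> X \<in> measurable M (count_space UNIV) \<and> countable (X ` space M)"

text \<open>
  As in \<open>KL_divergence\<close>, the reference measure is the first one: this is \<open>D(N \<parallel> M)\<close>, with base \<open>b\<close>
  logarithms. For probability measures and \<open>b > 1\<close> the negative part of the log-density is always
  \<open>N\<close>-integrable, so failure of integrability means \<open>D(N \<parallel> M) = \<infinity>\<close>, and the real value is nonnegative, so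
  \<open>ennreal\<close> does not truncate.
\<close>

definition ext_KL_divergence :: "real \<Rightarrow> 'a measure \<Rightarrow> 'a measure \<Rightarrow> ennreal" where
  "ext_KL_divergence b M N =
    (if absolutely_continuous M N \<and> integrable N (entropy_density b M N)
     then ennreal (KL_divergence b M N) else \<infinity>)"

definition mutual_info :: "'w measure \<Rightarrow> real \<Rightarrow> ('w \<Rightarrow> 'a) \<Rightarrow> ('w \<Rightarrow> 'b) \<Rightarrow> ennreal" where
  "mutual_info M b X Y =
    (let S = count_space (X ` space M); T = count_space (Y ` space M)
     in ext_KL_divergence b (distr M S X \<Otimes>\<^sub>M distr M T Y) (distr M (S \<Otimes>\<^sub>M T) (\<lambda>w. (X w, Y w))))"

text \<open>
  \<open>I(X; Y | Z) = \<Sum>z. P(Z = z) I(X; Y | Z = z)\<close>, where the last term is the mutual information under the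
  conditional probability measure given \<open>Z = z\<close>. The library's difference \<open>I(X; (Y, Z)) - I(X; Z)\<close> is
  not available here, since both terms may be infinite.
\<close>

definition cond_mutual_info ::
    "'w measure \<Rightarrow> real \<Rightarrow> ('w \<Rightarrow> 'a) \<Rightarrow> ('w \<Rightarrow> 'b) \<Rightarrow> ('w \<Rightarrow> 'c) \<Rightarrow> ennreal" where
  "cond_mutual_info M b X Y Z =
    (\<integral>\<^sup>+z. mutual_info (uniform_measure M (Z -` {z} \<inter> space M)) b X Y
       \<partial>distr M (count_space (Z ` space M)) Z)"

text \<open>For variables with finite range, these are the notions of the library.\<close>

lemma simple_function_discrete_rv: "simple_function M X \<Longrightarrow> discrete_rv M X"
  unfolding discrete_rv_def
  by (meson countable_finite measurable_simple_function simple_functionD(1))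

lemma (in information_space) mutual_info_simple:
  assumes X: "simple_function M X" and Y: "simple_function M Y"
  shows "mutual_info M b X Y = ennreal (\<I>(X ; Y))"
proof -
  let ?S = "count_space (X ` space M)" and ?T = "count_space (Y ` space M)"
  have fin: "finite (X ` space M)" "finite (Y ` space M)"
    using X Y by (auto simp: simple_functionD)
  have mX [measurable]: "X \<in> measurable M ?S" and mY [measurable]: "Y \<in> measurable M ?T"
    using X Y by (auto simp: measurable_count_space_eq2 simple_function_def fin)
  have ST: "?S \<Otimes>\<^sub>M ?T = count_space (X ` space M \<times> Y ` space M)"
    using fin by (rule pair_measure_count_space)
  let ?P = "distr M ?S X \<Otimes>\<^sub>M distr M ?T Y" and ?Q = "distr M (?S \<Otimes>\<^sub>M ?T) (\<lambda>w. (X w, Y w))"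
  interpret X: prob_space "distr M ?S X" by (rule prob_space_distr) simp
  interpret Y: prob_space "distr M ?T Y" by (rule prob_space_distr) simp
  interpret Q: prob_space ?Q by (rule prob_space_distr) simp
  have sP: "sets ?P = Pow (X ` space M \<times> Y ` space M)"
    using ST by (metis sets_count_space sets_distr sets_pair_measure_cong)
  have "A \<in> null_sets ?Q" if A: "A \<in> null_sets ?P" for A
  proof -
    have AP: "A \<subseteq> X ` space M \<times> Y ` space M"
      using A sP by (auto simp: null_sets_def)
    then have "finite A"
      using fin by (meson finite_SigmaI finite_subset)
    have "{p} \<in> null_sets ?Q" if "p \<in> A" for p
    proof -
      obtain x y where p: "p = (x, y)" by (cases p)
      have xy: "x \<in> X ` space M" "y \<in> Y ` space M" using that AP p by auto
      have "{p} \<in> null_sets ?P"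
        using A that AP sP by (auto intro: null_sets_subset[OF A])
      then have "emeasure (distr M ?S X) {x} * emeasure (distr M ?T Y) {y} = 0"
        using xy by (subst Y.emeasure_pair_measure_Times[symmetric]) (auto simp: p)
      then have "emeasure M (X -` {x} \<inter> space M) = 0 \<or> emeasure M (Y -` {y} \<inter> space M) = 0"
        using xy by (auto simp: emeasure_distr)
      moreover have "X -` {x} \<inter> space M \<in> sets M" "Y -` {y} \<inter> space M \<in> sets M"
        using simple_functionD(2)[OF X] simple_functionD(2)[OF Y] by auto
      ultimately have "emeasure M ((\<lambda>w. (X w, Y w)) -` {p} \<inter> space M) = 0"
        by (auto simp: p intro: emeasure_eq_0)
      moreover have "emeasure ?Q {p} = emeasure M ((\<lambda>w. (X w, Y w)) -` {p} \<inter> space M)"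
      proof (rule emeasure_distr)
        show "(\<lambda>w. (X w, Y w)) \<in> measurable M (?S \<Otimes>\<^sub>M ?T)" by measurable
        show "{p} \<in> sets (?S \<Otimes>\<^sub>M ?T)" using xy unfolding ST p by simp
      qed
      ultimately show ?thesis
        using xy by (auto simp: null_sets_def ST p)
    qed
    then have "(\<Union>p\<in>A. {p}) \<in> null_sets ?Q"
      using \<open>finite A\<close> by (intro null_sets.finite_UN) auto
    then show ?thesis by simp
  qed
  then have ac: "absolutely_continuous ?P ?Q"
    by (auto simp: absolutely_continuous_def)
  define B where "B = Max ((\<lambda>p. norm (entropy_density b ?P ?Q p)) ` (X ` space M \<times> Y ` space M))"
  have "integrable ?Q (entropy_density b ?P ?Q)"
  proof (rule Q.integrable_const_bound)
    show "AE p in ?Q. norm (entropy_density b ?P ?Q p) \<le> B"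
      unfolding B_def using fin
      by (intro AE_I2 Max_ge finite_imageI imageI) (auto simp: space_pair_measure)
  qed (simp add: ST)
  with ac show ?thesis
    by (simp add: mutual_info_def ext_KL_divergence_def mutual_information_def)
qed

lemma (in information_space) cond_mutual_info_simple:
  assumes X: "simple_function M X" and Y: "simple_function M Y" and Z: "simple_function M Z"
  shows "cond_mutual_info M b X Y Z = ennreal (\<I>(X ; Y | Z))"
proof -
  note sp = simple_function_Pair
  have fin [simp]: "finite (X ` space M)" "finite (Y ` space M)" "finite (Z ` space M)"
    using X Y Z by (auto simp: simple_functionD)
  define pz where "pz z = prob (Z -` {z} \<inter> space M)" for z
  define pxz where "pxz x z = prob ((\<lambda>w. (X w, Z w)) -` {(x, z)} \<inter> space M)" for x z
  define pyz where "pyz y z = prob ((\<lambda>w. (Y w, Z w)) -` {(y, z)} \<inter> space M)" for y z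
  define pxyz where "pxyz x y z = prob ((\<lambda>w. (X w, Y w, Z w)) -` {(x, y, z)} \<inter> space M)" for x y z
  define g where "g x y z = pxyz x y z * log b (pxyz x y z / (pxz x z * (pyz y z / pz z)))" for x y z
  have g0: "g x y z = 0" if "(x, y, z) \<notin> (\<lambda>w. (X w, Y w, Z w)) ` space M" for x y z
  proof -
    have "(\<lambda>w. (X w, Y w, Z w)) -` {(x, y, z)} \<inter> space M = {}" using that by auto
    then show ?thesis by (simp add: g_def pxyz_def)
  qed
  have "\<I>(X ; Y | Z) = (\<Sum>(x, y, z)\<in>(\<lambda>w. (X w, Y w, Z w)) ` space M. g x y z)"
    unfolding g_def pxyz_def pxz_def pyz_def pz_def
    by (subst conditional_mutual_information_eq[OF simple_distributedI[OF Z measure_nonneg refl]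
        simple_distributedI[OF sp[OF Y Z] measure_nonneg refl]
        simple_distributedI[OF sp[OF X Z] measure_nonneg refl]
        simple_distributedI[OF sp[OF X sp[OF Y Z]] measure_nonneg refl]]) simp
  also have "\<dots> = (\<Sum>(x, y, z)\<in>X ` space M \<times> Y ` space M \<times> Z ` space M. g x y z)"
    by (rule sum.mono_neutral_left) (auto intro!: g0)
  also have "\<dots> = (\<Sum>z\<in>Z ` space M. \<Sum>x\<in>X ` space M. \<Sum>y\<in>Y ` space M. g x y z)"
    by (simp add: sum.cartesian_product[symmetric] sum.swap[of _ "Z ` space M"])
  finally have I: "\<I>(X ; Y | Z) = \<dots>" .

  have summand: "mutual_info (uniform_measure M (Z -` {z} \<inter> space M)) b X Y * ennreal (pz z) =
      ennreal (\<Sum>x\<in>X ` space M. \<Sum>y\<in>Y ` space M. g x y z)" (is ?t)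
    and nonneg: "0 \<le> (\<Sum>x\<in>X ` space M. \<Sum>y\<in>Y ` space M. g x y z)" (is ?n)
    if z: "z \<in> Z ` space M" for z
  proof -
    let ?A = "Z -` {z} \<inter> space M"
    let ?U = "uniform_measure M ?A"
    have A [measurable]: "?A \<in> sets M" using Z by (rule simple_functionD)
    have "?t \<and> ?n"
    proof (cases "pz z = 0")
      case True
      have "pxyz x y z = 0" for x y
      proof -
        have "pxyz x y z \<le> pz z" unfolding pxyz_def pz_def
          by (rule finite_measure_mono) (auto intro: A)
        then show ?thesis using True by (simp add: pxyz_def measure_le_0_iff)
      qed
      then show ?thesis using True by (simp add: g_def)
    next
      case False
      then have pos: "0 < pz z" by (simp add: pz_def zero_less_measure_iff)
      interpret U: prob_space ?U
        using pos by (intro prob_space_uniform_measure) (auto simp: pz_def emeasure_eq_measure)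
      interpret U: information_space ?U b
        by standard (rule b_gt_1)
      have sf: "simple_function ?U X" "simple_function ?U Y"
        using X Y by (auto simp: simple_function_def)
      have mU: "measure ?U B = prob (?A \<inter> B) / pz z" if "B \<in> sets M" for B
        using that pos by (simp add: pz_def measure_uniform_measure emeasure_eq_measure)
      have 1: "measure ?U (X -` {x} \<inter> space M) = pxz x z / pz z" for x
        unfolding pxz_def by (subst mU) (auto intro!: simple_functionD[OF X] arg_cong[where f=prob])
      have 2: "measure ?U (Y -` {y} \<inter> space M) = pyz y z / pz z" for y
        unfolding pyz_def by (subst mU) (auto intro!: simple_functionD[OF Y] arg_cong[where f=prob])
      have 3: "measure ?U ((\<lambda>w. (X w, Y w)) -` {(x, y)} \<inter> space M) = pxyz x y z / pz z" for x y
        unfolding pxyz_def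
        by (subst mU) (auto intro!: simple_functionD[OF sp[OF X Y]] arg_cong[where f=prob])
      have g': "pxyz x y z / pz z * log b (pxyz x y z / pz z / (pxz x z / pz z * (pyz y z / pz z))) =
          g x y z / pz z" for x y
        using pos by (simp add: g_def field_simps)
      have "U.mutual_information b (count_space (X ` space ?U)) (count_space (Y ` space ?U)) X Y =
        (\<Sum>(x, y)\<in>(\<lambda>w. (X w, Y w)) ` space M. g x y z / pz z)"
        by (subst U.mutual_information_simple_distributed[OF
              U.simple_distributedI[OF sf(1) measure_nonneg refl]
              U.simple_distributedI[OF sf(2) measure_nonneg refl]
              U.simple_distributedI[OF sp[OF sf] measure_nonneg refl]])
           (simp only: 1 2 3 g' space_uniform_measure)
      also have "\<dots> = (\<Sum>(x, y)\<in>X ` space M \<times> Y ` space M. g x y z / pz z)"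
        by (rule sum.mono_neutral_left) (auto intro!: g0)
      also have "\<dots> = (\<Sum>x\<in>X ` space M. \<Sum>y\<in>Y ` space M. g x y z) / pz z"
        by (simp add: sum.cartesian_product sum_divide_distrib case_prod_beta)
      finally have MI: "U.mutual_information b (count_space (X ` space ?U)) (count_space (Y ` space ?U)) X Y = \<dots>" .
      have nn: "0 \<le> (\<Sum>x\<in>X ` space M. \<Sum>y\<in>Y ` space M. g x y z)"
        using U.mutual_information_nonneg_simple[OF sf] pos unfolding MI
        by (simp add: zero_le_divide_iff)
      then show ?thesis
        unfolding U.mutual_info_simple[OF sf] MI using pos
        by (simp add: ennreal_mult[symmetric])
    qed
    then show ?t ?n by auto
  qed

  have mZ: "Z \<in> measurable M (count_space (Z ` space M))"
    using Z by (simp add: measurable_count_space_eq2 simple_function_def)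
  let ?D = "distr M (count_space (Z ` space M)) Z"
  let ?m = "\<lambda>z. mutual_info (uniform_measure M (Z -` {z} \<inter> space M)) b X Y"
  have "cond_mutual_info M b X Y Z = (\<integral>\<^sup>+z. ?m z * indicator (Z ` space M) z \<partial>?D)"
    unfolding cond_mutual_info_def by (rule nn_integral_cong) simp
  also have "\<dots> = (\<Sum>z\<in>Z ` space M. ?m z * emeasure ?D {z})"
    by (rule nn_integral_indicator_finite) auto
  also have "\<dots> = (\<Sum>z\<in>Z ` space M. ?m z * ennreal (pz z))"
    by (intro sum.cong refl) (simp add: emeasure_distr[OF mZ] emeasure_eq_measure pz_def)
  also have "\<dots> = ennreal (\<I>(X ; Y | Z))"
    unfolding I using nonneg by (simp add: summand sum_ennreal cong: sum.cong)
  finally show ?thesis .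
qed

end

theory Submission
  imports Defs
begin

text \<open>
  With \<open>\<phi> u = u ln u - u + 1 \<ge> 0\<close> and independent copies of the probability space,
  \<open>I(X; Y)\<close> is, up to the factor \<open>1 / ln b\<close>, the integral of \<open>\<phi> (r (X w) (Y v))\<close> over \<open>(w, v)\<close>,
  where \<open>r\<close> is the ratio of the joint to the product probabilities; as \<open>\<phi>\<close> is nonnegative, this
  also covers the value \<open>\<infinity>\<close>. If \<open>X\<close> and \<open>Y\<close> are independent given \<open>Z\<close>, the ratio for \<open>(X, Y)\<close>
  at \<open>(a, c)\<close> is the conditional mean of the ratio for \<open>(Z, Y)\<close> given \<open>X = a\<close>, so Jensen's
  inequality and the tower property give \<open>I(X; Y) \<le> I(Z; Y)\<close>. The theorem is the chain
  \<open>I(z2; y) \<le> I(x; y) \<le> I(xt; y) \<le> I(z1; y)\<close>, each step being an instance.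
\<close>

definition kl_fun :: "real \<Rightarrow> real" where
  "kl_fun u = u * ln u - u + 1"

lemma kl_fun_ge_tangent: "1 - v + u * ln v \<le> kl_fun u" if "0 \<le> u" "0 < v"
proof (cases "u = 0")
  case False
  then have u: "0 < u" using that by simp
  then have "u * ln (v / u) \<le> u * (v / u - 1)"
    using that by (intro mult_left_mono ln_le_minus_one) auto
  then show ?thesis
    using that u by (simp add: kl_fun_def ln_div algebra_simps)
qed (use that in \<open>simp add: kl_fun_def\<close>)

lemma kl_fun_nonneg: "0 \<le> u \<Longrightarrow> 0 \<le> kl_fun u"
  using kl_fun_ge_tangent[of u 1] by simp

lemma kl_fun_eq_0D: "u = 1" if "0 \<le> u" "kl_fun u = 0"
proof -
  have u: "0 < u" using that by (cases "u = 0") (auto simp: kl_fun_def)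
  then have "ln (1 / u) = 1 / u - 1"
    using that by (simp add: kl_fun_def ln_div field_simps)
  then show ?thesis using u ln_eq_minus_one[of "1 / u"] by simp
qed

lemma kl_fun_measurable [measurable]: "kl_fun \<in> borel_measurable borel"
  unfolding kl_fun_def by measurable

lemma (in prob_space) kl_fun_jensen:
  assumes f [measurable]: "f \<in> borel_measurable M" and f0: "\<And>w. 0 \<le> f w"
    and v: "(\<integral>\<^sup>+w. ennreal (f w) \<partial>M) = ennreal v" "0 \<le> v"
  shows "ennreal (kl_fun v) \<le> (\<integral>\<^sup>+w. ennreal (kl_fun (f w)) \<partial>M)"
proof (cases "v = 0")
  case True
  then have "AE w in M. f w = 0"
    using v f0 by (auto simp: nn_integral_0_iff_AE)
  then have "(\<integral>\<^sup>+w. ennreal (kl_fun (f w)) \<partial>M) = (\<integral>\<^sup>+w. 1 \<partial>M)"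
    by (intro nn_integral_cong_AE) (auto simp: kl_fun_def)
  then show ?thesis using True by (simp add: kl_fun_def emeasure_space_1)
next
  case False
  then have v0: "0 < v" using v by simp
  show ?thesis
  proof (cases "(\<integral>\<^sup>+w. ennreal (kl_fun (f w)) \<partial>M) = \<infinity>")
    case False
    have intf: "integrable M f"
      using v f0 by (intro integrableI_nonneg) auto
    have intk: "integrable M (\<lambda>w. kl_fun (f w))"
      using False f0 by (intro integrableI_nonneg) (auto simp: kl_fun_nonneg less_top)
    have "expectation f = v"
      using v f0 by (intro integral_eq_nn_integral[THEN trans]) auto
    then have "kl_fun v = expectation (\<lambda>w. 1 - v + f w * ln v)"
      using intf by (simp add: prob_space kl_fun_def)
    also have "\<dots> \<le> expectation (\<lambda>w. kl_fun (f w))"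
      using intf intk f0 v0 by (intro integral_mono kl_fun_ge_tangent) auto
    finally show ?thesis
      using intk f0 by (simp add: nn_integral_eq_integral kl_fun_nonneg)
  qed auto
qed

lemma ext_KL_divergence_density:
  assumes b: "1 < b" and "prob_space M" and f [measurable]: "f \<in> borel_measurable M"
    and f0: "\<And>w. 0 \<le> f w" and N: "prob_space (density M (\<lambda>w. ennreal (f w)))"
  shows "ext_KL_divergence b M (density M f) = (\<integral>\<^sup>+w. ennreal (kl_fun (f w) / ln b) \<partial>M)"
proof -
  interpret prob_space M by fact
  interpret N: prob_space "density M f" by fact
  have lnb: "0 < ln b" using b by simp
  have ac: "absolutely_continuous M (density M f)"
    by (auto intro!: absolutely_continuousI_density)
  have "(\<integral>\<^sup>+w. ennreal (f w) \<partial>M) = 1"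
    using N.emeasure_space_1 by (subst (asm) emeasure_density) (auto cong: nn_integral_cong_simp)
  then have intf: "integrable M f" and If: "expectation f = 1"
    using f0 by (auto intro: integrableI_nonneg simp: integral_eq_nn_integral)
  have flog: "f w * log b (f w) = kl_fun (f w) / ln b + (f w - 1) / ln b" for w
    by (simp add: kl_fun_def log_def add_divide_distrib[symmetric])
  have g: "integrable M (\<lambda>w. (f w - 1) / ln b)"
    using intf by (intro integrable_divide_zero Bochner_Integration.integrable_diff) auto
  have "expectation (\<lambda>w. (f w - 1) / ln b) = (expectation f - 1) / ln b"
    using intf by (simp add: prob_space)
  then have Ig: "expectation (\<lambda>w. (f w - 1) / ln b) = 0"
    using If by simp
  have "AE w in M. RN_deriv M (density M f) w = f w"
    by (rule AE_symmetric[OF RN_deriv_unique[OF _ refl]]) measurable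
  then have "AE w in density M f. entropy_density b M (density M f) w = log b (f w)"
    using f0 by (auto simp: AE_density entropy_density_def)
  then have "integrable (density M f) (entropy_density b M (density M f)) \<longleftrightarrow>
      integrable (density M f) (\<lambda>w. log b (f w))"
    by (intro integrable_cong_AE) auto
  also have "\<dots> \<longleftrightarrow> integrable M (\<lambda>w. f w * log b (f w))"
    using f0 by (subst integrable_density) auto
  also have "\<dots> \<longleftrightarrow> integrable M (\<lambda>w. kl_fun (f w) / ln b)"
  proof
    assume "integrable M (\<lambda>w. f w * log b (f w))"
    from Bochner_Integration.integrable_diff[OF this g]
    show "integrable M (\<lambda>w. kl_fun (f w) / ln b)" by (simp add: flog)
  next
    assume "integrable M (\<lambda>w. kl_fun (f w) / ln b)"
    from Bochner_Integration.integrable_add[OF this g]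
    show "integrable M (\<lambda>w. f w * log b (f w))" by (simp only: flog)
  qed
  finally have iff: "integrable (density M f) (entropy_density b M (density M f)) \<longleftrightarrow>
      integrable M (\<lambda>w. kl_fun (f w) / ln b)" .
  have k0: "0 \<le> kl_fun (f w) / ln b" for w
    using f0 lnb by (simp add: kl_fun_nonneg)
  show ?thesis
  proof (cases "integrable M (\<lambda>w. kl_fun (f w) / ln b)")
    case True
    have "KL_divergence b M (density M f) = (\<integral>w. f w * log b (f w) \<partial>M)"
      using f0 b by (intro KL_density) auto
    also have "\<dots> = (\<integral>w. kl_fun (f w) / ln b \<partial>M)"
      unfolding flog Bochner_Integration.integral_add[OF True g] Ig by simp
    finally show ?thesis
      using True k0 ac iff by (simp add: ext_KL_divergence_def nn_integral_eq_integral)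
  next
    case False
    then have "(\<integral>\<^sup>+w. ennreal (kl_fun (f w) / ln b) \<partial>M) = \<infinity>"
      by (rule contrapos_np, intro integrableI_nonneg) (use k0 in \<open>auto simp: top.not_eq_extremum\<close>)
    then show ?thesis
      using False iff by (simp add: ext_KL_divergence_def)
  qed
qed

lemma discrete_rv_measurable [measurable_dest]:
  "discrete_rv M X \<Longrightarrow> X \<in> measurable M (count_space UNIV)"
  by (simp add: discrete_rv_def)

lemma discrete_rv_measurable_image:
  "discrete_rv M X \<Longrightarrow> X \<in> measurable M (count_space (X ` space M))"
  by (auto simp: discrete_rv_def measurable_def vimage_def)

lemma discrete_rv_Pair:
  assumes "discrete_rv M X" "discrete_rv M Y"
  shows "discrete_rv M (\<lambda>w. (X w, Y w))"
proof -
  have 1: "X \<in> measurable M (count_space (X ` space M))" "countable (X ` space M)"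
    using assms discrete_rv_measurable_image by (auto simp: discrete_rv_def)
  have 2: "Y \<in> measurable M (count_space UNIV)" "countable (Y ` space M)"
    using assms by (auto simp: discrete_rv_def)
  have "(\<lambda>w. (X w, Y w)) ` space M \<subseteq> X ` space M \<times> Y ` space M" by auto
  moreover have "(\<lambda>w. (X w, Y w)) \<in> measurable M (count_space UNIV)"
    by (rule measurable_compose_countable'[where f = "\<lambda>a w. (a, Y w)", OF _ 1(1) 1(2)])
       (rule measurable_compose[OF 2(1)], simp)
  ultimately show ?thesis
    using 1(2) 2(2) by (simp add: discrete_rv_def countable_subset[OF _ countable_SIGMA])
qed

lemma discrete_rv_measurable_pair:
  assumes X: "discrete_rv M X" and Y: "discrete_rv N Y"
  shows "(\<lambda>p. g (X (fst p)) (Y (snd p))) \<in> measurable (M \<Otimes>\<^sub>M N) (count_space UNIV)"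
proof (rule measurable_compose_countable'[where f = "\<lambda>a p. g a (Y (snd p))" and I = "X ` space M"])
  show "(\<lambda>p. g a (Y (snd p))) \<in> measurable (M \<Otimes>\<^sub>M N) (count_space UNIV)" for a
    by (rule measurable_compose[OF measurable_snd]) (rule measurable_compose[OF discrete_rv_measurable[OF Y]], simp)
  show "(\<lambda>p. X (fst p)) \<in> measurable (M \<Otimes>\<^sub>M N) (count_space (X ` space M))"
    by (rule measurable_compose[OF measurable_fst discrete_rv_measurable_image[OF X]])
qed (use X in \<open>simp add: discrete_rv_def\<close>)

definition dep_ratio :: "'w measure \<Rightarrow> ('w \<Rightarrow> 'a) \<Rightarrow> ('w \<Rightarrow> 'b) \<Rightarrow> 'a \<Rightarrow> 'b \<Rightarrow> real" where
  "dep_ratio M X Y a c =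
    \<P>(w in M. X w = a \<and> Y w = c) / (\<P>(w in M. X w = a) * \<P>(w in M. Y w = c))"

lemma dep_ratio_nonneg: "0 \<le> dep_ratio M X Y a c"
  by (simp add: dep_ratio_def)

lemma (in prob_space) discrete_rv_event [measurable]:
  assumes "discrete_rv M X"
  shows "{w\<in>space M. X w = a} \<in> events"
  using measurable_sets[OF discrete_rv_measurable[OF assms], of "{a}"]
  by (simp add: vimage_def Int_def conj_commute)

lemma (in information_space) mutual_info_eq_nn_integral:
  assumes X: "discrete_rv M X" and Y: "discrete_rv M Y"
  shows "mutual_info M b X Y = ennreal (1 / ln b) *
    (\<integral>\<^sup>+w. \<integral>\<^sup>+v. ennreal (kl_fun (dep_ratio M X Y (X w) (Y v))) \<partial>M \<partial>M)"
proof -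
  let ?I = "X ` space M" and ?J = "Y ` space M"
  let ?S = "count_space ?I" and ?T = "count_space ?J"
  have c: "countable ?I" "countable ?J" using X Y by (auto simp: discrete_rv_def)
  note [measurable] = discrete_rv_measurable_image[OF X] discrete_rv_measurable_image[OF Y]
  have ST: "?S \<Otimes>\<^sub>M ?T = count_space (?I \<times> ?J)"
    by (rule pair_measure_countable[OF c])
  have sST: "sets (?S \<Otimes>\<^sub>M ?T) = Pow (?I \<times> ?J)"
    unfolding ST by simp
  have mXY: "(\<lambda>w. (X w, Y w)) \<in> measurable M (?S \<Otimes>\<^sub>M ?T)"
    by measurable
  let ?PX = "distr M ?S X" and ?PY = "distr M ?T Y"
  let ?P = "?PX \<Otimes>\<^sub>M ?PY" and ?Q = "distr M (?S \<Otimes>\<^sub>M ?T) (\<lambda>w. (X w, Y w))"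
  let ?f = "\<lambda>p. dep_ratio M X Y (fst p) (snd p)"
  interpret X: prob_space ?PX by (rule prob_space_distr) simp
  interpret Y: prob_space ?PY by (rule prob_space_distr) simp
  interpret XY: pair_prob_space ?PX ?PY ..
  interpret Q: prob_space ?Q by (rule prob_space_distr) simp
  have sP: "sets ?P = Pow (?I \<times> ?J)"
    using ST by (metis sets_count_space sets_distr sets_pair_measure_cong)
  have sP': "sets ?P = sets (count_space (?I \<times> ?J))" using sP by simp
  have mP: "g \<in> borel_measurable ?P" for g :: "_ \<Rightarrow> 'z::topological_space"
    by (subst measurable_cong_sets[OF sP' refl]) (rule measurable_count_space_eq1[THEN iffD2], simp)
  have Q: "?Q = density ?P ?f"
  proof (rule measure_eqI_countable)
    show "sets ?Q = Pow (?I \<times> ?J)" "sets (density ?P ?f) = Pow (?I \<times> ?J)"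
      using ST sP by simp_all
    show "countable (?I \<times> ?J)" using c by auto
    fix p assume p: "p \<in> ?I \<times> ?J"
    obtain a d where ad: "p = (a, d)" by (cases p)
    have [simp]: "X -` {a} \<inter> space M = {w\<in>space M. X w = a}" "Y -` {d} \<inter> space M = {w\<in>space M. Y w = d}" by auto
    have "emeasure ?P {p} = emeasure ?PX {a} * emeasure ?PY {d}"
      using p by (subst Y.emeasure_pair_measure_Times[symmetric]) (auto simp: ad)
    also have "\<dots> = ennreal (\<P>(w in M. X w = a) * \<P>(w in M. Y w = d))"
      using p by (simp add: emeasure_distr ad emeasure_eq_measure ennreal_mult')
    finally have P: "emeasure ?P {p} = \<dots>" .
    have "emeasure ?Q {p} = \<P>(w in M. X w = a \<and> Y w = d)"
      using p by (subst emeasure_distr[OF mXY])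
        (auto simp: sST ad emeasure_eq_measure intro!: arg_cong[where f = prob])
    also have "\<dots> = ennreal (?f p) * ennreal (\<P>(w in M. X w = a) * \<P>(w in M. Y w = d))"
    proof -
      have "\<P>(w in M. X w = a \<and> Y w = d) \<le> \<P>(w in M. X w = a)"
        "\<P>(w in M. X w = a \<and> Y w = d) \<le> \<P>(w in M. Y w = d)"
        using X Y by (auto intro!: finite_measure_mono discrete_rv_event)
      then have "\<P>(w in M. X w = a \<and> Y w = d) = ?f p * (\<P>(w in M. X w = a) * \<P>(w in M. Y w = d))"
        by (auto simp: dep_ratio_def ad measure_le_0_iff)
      then show ?thesis by (simp add: ennreal_mult'[symmetric] dep_ratio_nonneg)
    qed
    also have "\<dots> = emeasure (density ?P ?f) {p}"
    proof -
      have "emeasure (density ?P ?f) {p} = (\<integral>\<^sup>+q. ennreal (?f p) * indicator {p} q \<partial>?P)"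
        using p by (subst emeasure_density) (auto simp: sP mP intro!: nn_integral_cong split: split_indicator)
      also have "\<dots> = ennreal (?f p) * emeasure ?P {p}"
        using p sP by (subst nn_integral_cmult_indicator) auto
      finally show ?thesis using P by simp
    qed
    finally show "emeasure ?Q {p} = emeasure (density ?P ?f) {p}" .
  qed
  have "mutual_info M b X Y = (\<integral>\<^sup>+p. ennreal (kl_fun (?f p) / ln b) \<partial>?P)"
    unfolding mutual_info_def Let_def Q
    by (rule ext_KL_divergence_density[OF b_gt_1 _ mP])
       (use Q Q.prob_space_axioms XY.prob_space_axioms in \<open>auto simp: dep_ratio_nonneg\<close>)
  also have "\<dots> = (\<integral>\<^sup>+p. ennreal (1 / ln b) * ennreal (kl_fun (?f p)) \<partial>?P)"
    using b_gt_1 by (simp add: ennreal_mult[symmetric] kl_fun_nonneg dep_ratio_nonneg)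
  also have "\<dots> = ennreal (1 / ln b) * (\<integral>\<^sup>+p. ennreal (kl_fun (?f p)) \<partial>?P)"
    by (rule nn_integral_cmult[OF mP])
  also have "(\<integral>\<^sup>+p. ennreal (kl_fun (?f p)) \<partial>?P) =
      (\<integral>\<^sup>+a. \<integral>\<^sup>+d. ennreal (kl_fun (dep_ratio M X Y a d)) \<partial>?PY \<partial>?PX)"
    by (subst Y.nn_integral_fst[symmetric, OF mP]) simp
  also have "\<dots> = (\<integral>\<^sup>+w. \<integral>\<^sup>+v. ennreal (kl_fun (dep_ratio M X Y (X w) (Y v))) \<partial>M \<partial>M)"
    by (simp add: nn_integral_distr)
  finally show ?thesis .
qed

lemma (in prob_space) AE_discrete_rv_pos:
  assumes X: "discrete_rv M X"
  shows "AE w in M. 0 < \<P>(v in M. X v = X w)"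
proof -
  have "AE w in M. \<forall>a\<in>{a\<in>X ` space M. \<P>(v in M. X v = a) = 0}. X w \<noteq> a"
  proof (subst AE_ball_countable)
    show "countable {a\<in>X ` space M. \<P>(v in M. X v = a) = 0}"
      using X by (auto simp: discrete_rv_def intro: countable_subset)
    show "\<forall>a\<in>{a\<in>X ` space M. \<P>(v in M. X v = a) = 0}. AE w in M. X w \<noteq> a"
      using X by (auto simp: prob_eq_0[OF discrete_rv_event])
  qed
  with AE_space show ?thesis
    by eventually_elim (auto simp: zero_less_measure_iff)
qed

lemma (in prob_space) nn_integral_tower:
  assumes Z: "discrete_rv M Z" and h [measurable]: "h \<in> borel_measurable M"
  shows "(\<integral>\<^sup>+w. \<integral>\<^sup>+v. h v \<partial>uniform_measure M {v\<in>space M. Z v = Z w} \<partial>M) = (\<integral>\<^sup>+v. h v \<partial>M)"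
proof -
  interpret MM: pair_prob_space M M ..
  let ?k = "\<lambda>a c. (if c = a then 1 / ennreal (\<P>(v in M. Z v = a)) else 0)"
  have [measurable]: "(\<lambda>p. ?k (Z (fst p)) (Z (snd p))) \<in> borel_measurable (M \<Otimes>\<^sub>M M)"
    by (rule measurable_compose[OF discrete_rv_measurable_pair[OF Z Z, of ?k], of "\<lambda>u. u" borel]) simp
  have [measurable]: "(\<lambda>v. ?k a (Z v)) \<in> borel_measurable M" for a
    by (rule measurable_compose[OF discrete_rv_measurable[OF Z]]) simp
  have [measurable]: "(\<lambda>v. ?k (Z v) a) \<in> borel_measurable M" for a
    by (rule measurable_compose[OF discrete_rv_measurable[OF Z]]) simp
  have "(\<integral>\<^sup>+w. \<integral>\<^sup>+v. h v \<partial>uniform_measure M {v\<in>space M. Z v = Z w} \<partial>M) =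
      (\<integral>\<^sup>+w. \<integral>\<^sup>+v. h v * ?k (Z w) (Z v) \<partial>M \<partial>M)"
  proof (rule nn_integral_cong)
    fix w
    have "(\<integral>\<^sup>+v. h v \<partial>uniform_measure M {v\<in>space M. Z v = Z w}) =
        (\<integral>\<^sup>+v. h v * indicator {v\<in>space M. Z v = Z w} v * (1 / ennreal (\<P>(v in M. Z v = Z w))) \<partial>M)"
      using Z by (subst nn_integral_uniform_measure)
        (auto simp: nn_integral_multc emeasure_eq_measure divide_ennreal_def discrete_rv_event)
    also have "\<dots> = (\<integral>\<^sup>+v. h v * ?k (Z w) (Z v) \<partial>M)"
      by (intro nn_integral_cong) (auto split: split_indicator)
    finally show "(\<integral>\<^sup>+v. h v \<partial>uniform_measure M {v\<in>space M. Z v = Z w}) = \<dots>" .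
  qed
  also have "\<dots> = (\<integral>\<^sup>+v. \<integral>\<^sup>+w. h v * ?k (Z w) (Z v) \<partial>M \<partial>M)"
    by (rule MM.Fubini'[symmetric, of "\<lambda>w v. h v * ?k (Z w) (Z v)"]) (simp add: case_prod_beta)
  also have "\<dots> = (\<integral>\<^sup>+v. h v \<partial>M)"
  proof (rule nn_integral_cong_AE)
    show "AE v in M. (\<integral>\<^sup>+w. h v * ?k (Z w) (Z v) \<partial>M) = h v"
      using AE_discrete_rv_pos[OF Z]
    proof eventually_elim
      case (elim v)
      have "(\<integral>\<^sup>+w. ?k (Z w) (Z v) \<partial>M) =
          (\<integral>\<^sup>+w. 1 / ennreal (\<P>(w in M. Z w = Z v)) * indicator {w\<in>space M. Z w = Z v} w \<partial>M)"
        by (intro nn_integral_cong) (auto split: split_indicator)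
      also have "\<dots> = 1 / ennreal (\<P>(w in M. Z w = Z v)) * ennreal (\<P>(w in M. Z w = Z v))"
        using Z by (subst nn_integral_cmult_indicator) (auto simp: emeasure_eq_measure discrete_rv_event)
      also have "\<dots> = 1"
        using elim by (simp add: ennreal_1[symmetric] divide_ennreal ennreal_mult[symmetric] del: ennreal_1)
      finally show ?case by (simp add: nn_integral_cmult)
    qed
  qed
  finally show ?thesis .
qed

definition cond_indep_rv :: "'w measure \<Rightarrow> ('w \<Rightarrow> 'a) \<Rightarrow> ('w \<Rightarrow> 'b) \<Rightarrow> ('w \<Rightarrow> 'c) \<Rightarrow> bool" where
  "cond_indep_rv M X Y Z \<longleftrightarrow> (\<forall>a c d.
    \<P>(w in M. X w = a \<and> Y w = c \<and> Z w = d) * \<P>(w in M. Z w = d) =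
    \<P>(w in M. X w = a \<and> Z w = d) * \<P>(w in M. Y w = c \<and> Z w = d))"

lemma nn_integral_ge_singleton:
  assumes "{a} \<in> sets M"
  shows "f a * emeasure M {a} \<le> (\<integral>\<^sup>+w. f w \<partial>M)"
proof -
  have "f a * emeasure M {a} = (\<integral>\<^sup>+w. f a * indicator {a} w \<partial>M)"
    using assms by (subst nn_integral_cmult_indicator) auto
  also have "\<dots> \<le> (\<integral>\<^sup>+w. f w \<partial>M)"
    by (intro nn_integral_mono) (auto split: split_indicator)
  finally show ?thesis .
qed


lemma (in information_space) indep_if_mutual_info_eq_0:
  assumes X: "discrete_rv M X" and Y: "discrete_rv M Y" and 0: "mutual_info M b X Y = 0"
  shows "\<P>(w in M. X w = a \<and> Y w = c) = \<P>(w in M. X w = a) * \<P>(w in M. Y w = c)"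
proof (cases "\<P>(w in M. X w = a) = 0 \<or> \<P>(w in M. Y w = c) = 0")
  case True
  have "\<P>(w in M. X w = a \<and> Y w = c) \<le> \<P>(w in M. X w = a)"
    "\<P>(w in M. X w = a \<and> Y w = c) \<le> \<P>(w in M. Y w = c)"
    using X Y by (auto intro!: finite_measure_mono discrete_rv_event)
  then show ?thesis using True by (auto simp: measure_le_0_iff)
next
  case False
  let ?A = "{w\<in>space M. X w = a}" and ?C = "{w\<in>space M. Y w = c}"
  let ?k = "\<lambda>a c. ennreal (kl_fun (dep_ratio M X Y a c))"
  have [measurable]: "?A \<in> events" "?C \<in> events"
    using X Y by (auto intro: discrete_rv_event)
  have "?k a c * emeasure M ?C * emeasure M ?A =
      (\<integral>\<^sup>+w. (\<integral>\<^sup>+v. ?k a c * indicator ?C v \<partial>M) * indicator ?A w \<partial>M)"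
    by (simp add: nn_integral_cmult_indicator)
  also have "\<dots> \<le> (\<integral>\<^sup>+w. \<integral>\<^sup>+v. ?k (X w) (Y v) \<partial>M \<partial>M)"
    by (intro nn_integral_mono) (auto split: split_indicator intro!: nn_integral_mono)
  also have "\<dots> = 0"
    using 0 b_gt_1 by (simp add: mutual_info_eq_nn_integral[OF X Y])
  finally have "?k a c = 0"
    using False by (auto simp: emeasure_eq_measure)
  then have "kl_fun (dep_ratio M X Y a c) = 0"
    using kl_fun_nonneg[OF dep_ratio_nonneg, of M X Y a c] by simp
  then have "dep_ratio M X Y a c = 1"
    by (rule kl_fun_eq_0D[OF dep_ratio_nonneg])
  then show ?thesis using False by (simp add: dep_ratio_def)
qed

lemma (in information_space) cond_indep_if_cond_mutual_info_eq_0: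
  assumes X: "discrete_rv M X" and Y: "discrete_rv M Y" and Z: "discrete_rv M Z"
    and 0: "cond_mutual_info M b X Y Z = 0"
  shows "cond_indep_rv M X Y Z"
  unfolding cond_indep_rv_def
proof (intro allI)
  fix a c d
  let ?D = "{w\<in>space M. Z w = d}"
  have [measurable]: "?D \<in> events" "{w\<in>space M. X w = a} \<in> events" "{w\<in>space M. Y w = c} \<in> events"
    using X Y Z by (auto intro: discrete_rv_event)
  have XY: "{w\<in>space M. X w = a \<and> Y w = c} \<in> events"
    by (rule sets.sets_Collect_conj) fact+
  show "\<P>(w in M. X w = a \<and> Y w = c \<and> Z w = d) * \<P>(w in M. Z w = d) =
    \<P>(w in M. X w = a \<and> Z w = d) * \<P>(w in M. Y w = c \<and> Z w = d)"
  proof (cases "prob ?D = 0")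
    case True
    have "\<P>(w in M. X w = a \<and> Z w = d) \<le> prob ?D"
      by (rule finite_measure_mono) auto
    then show ?thesis using True by (simp add: measure_le_0_iff)
  next
    case False
    then have pos: "0 < prob ?D" by (simp add: zero_less_measure_iff)
    have "?D \<noteq> {}" using pos by (metis measure_empty less_irrefl)
    then have d: "d \<in> Z ` space M" by auto
    let ?U = "uniform_measure M ?D"
    have D: "Z -` {d} \<inter> space M = ?D" by auto
    interpret U: prob_space ?U
      using pos by (intro prob_space_uniform_measure) (auto simp: emeasure_eq_measure)
    interpret U: information_space ?U b
      by standard (rule b_gt_1)
    have dU: "discrete_rv ?U X" "discrete_rv ?U Y"
      using X Y by (auto simp: discrete_rv_def measurable_cong_sets[OF sets_uniform_measure refl])
    let ?N = "distr M (count_space (Z ` space M)) Z"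
    have "emeasure ?N {d} = prob ?D"
      using d by (subst emeasure_distr[OF discrete_rv_measurable_image[OF Z]])
        (auto simp: D emeasure_eq_measure)
    moreover have "mutual_info ?U b X Y * emeasure ?N {d} \<le> cond_mutual_info M b X Y Z"
      unfolding cond_mutual_info_def
      using nn_integral_ge_singleton[of d ?N "\<lambda>z. mutual_info (uniform_measure M (Z -` {z} \<inter> space M)) b X Y"] d
      by (simp add: D)
    ultimately have "mutual_info ?U b X Y = 0"
      using 0 pos by simp
    note ind = U.indep_if_mutual_info_eq_0[OF dU this, of a c]
    have mU: "measure ?U B = prob (?D \<inter> B) / prob ?D" if "B \<in> events" for B
      using that pos by (intro measure_uniform_measure) (auto simp: emeasure_eq_measure)
    have XYZ: "measure ?U {w\<in>space ?U. X w = a \<and> Y w = c} = prob {w\<in>space M. X w = a \<and> Y w = c \<and> Z w = d} / prob ?D"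
      and XZ: "measure ?U {w\<in>space ?U. X w = a} = prob {w\<in>space M. X w = a \<and> Z w = d} / prob ?D"
      and YZ: "measure ?U {w\<in>space ?U. Y w = c} = prob {w\<in>space M. Y w = c \<and> Z w = d} / prob ?D"
      using XY by (auto simp: mU intro!: arg_cong2[where f = "(/)"] arg_cong[where f = prob])
    have "prob {w\<in>space M. X w = a \<and> Y w = c \<and> Z w = d} / prob ?D =
        prob {w\<in>space M. X w = a \<and> Z w = d} / prob ?D * (prob {w\<in>space M. Y w = c \<and> Z w = d} / prob ?D)"
      using ind unfolding XYZ XZ YZ .
    then show ?thesis using pos by (simp add: field_simps)
  qed
qed

lemma (in prob_space) nn_integral_tower_indicator:
  assumes Z: "discrete_rv M Z" and E [measurable]: "E \<in> events"
    and g: "\<And>d. 0 \<le> g d"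
  shows "(\<integral>\<^sup>+v. ennreal (g (Z v)) * indicator E v \<partial>M) =
    (\<integral>\<^sup>+w. ennreal (g (Z w) * prob {v\<in>E. Z v = Z w} / \<P>(v in M. Z v = Z w)) \<partial>M)"
proof -
  have [measurable]: "(\<lambda>v. g (Z v)) \<in> borel_measurable M"
    by (rule measurable_compose[OF discrete_rv_measurable[OF Z]]) simp
  have "(\<integral>\<^sup>+v. ennreal (g (Z v)) * indicator E v \<partial>M) =
      (\<integral>\<^sup>+w. \<integral>\<^sup>+v. ennreal (g (Z v)) * indicator E v \<partial>uniform_measure M {v\<in>space M. Z v = Z w} \<partial>M)"
    by (rule nn_integral_tower[OF Z, symmetric]) measurable
  also have "\<dots> = (\<integral>\<^sup>+w. ennreal (g (Z w) * prob {v\<in>E. Z v = Z w} / \<P>(v in M. Z v = Z w)) \<partial>M)"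
  proof (rule nn_integral_cong_AE)
    show "AE w in M. (\<integral>\<^sup>+v. ennreal (g (Z v)) * indicator E v \<partial>uniform_measure M {v\<in>space M. Z v = Z w}) =
        ennreal (g (Z w) * prob {v\<in>E. Z v = Z w} / \<P>(v in M. Z v = Z w))"
      using AE_discrete_rv_pos[OF Z]
    proof eventually_elim
      case (elim w)
      let ?D = "{v\<in>space M. Z v = Z w}"
      have D [measurable]: "?D \<in> events" using Z by (rule discrete_rv_event)
      have ED: "{v\<in>E. Z v = Z w} = E \<inter> ?D" using sets.sets_into_space[OF E] by auto
      have "(\<integral>\<^sup>+v. ennreal (g (Z v)) * indicator E v \<partial>uniform_measure M ?D) =
          (\<integral>\<^sup>+v. ennreal (g (Z v)) * indicator E v * indicator ?D v \<partial>M) / prob ?D"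
        by (subst nn_integral_uniform_measure) (auto simp: emeasure_eq_measure)
      also have "(\<integral>\<^sup>+v. ennreal (g (Z v)) * indicator E v * indicator ?D v \<partial>M) =
          (\<integral>\<^sup>+v. ennreal (g (Z w)) * indicator (E \<inter> ?D) v \<partial>M)"
        by (intro nn_integral_cong) (auto split: split_indicator)
      also have "\<dots> = ennreal (g (Z w) * prob (E \<inter> ?D))"
        using g by (subst nn_integral_cmult_indicator) (auto simp: emeasure_eq_measure ennreal_mult)
      also have "\<dots> / ennreal (prob ?D) = ennreal (g (Z w) * prob (E \<inter> ?D) / prob ?D)"
        using elim g by (intro divide_ennreal) auto
      finally show ?case by (simp only: ED)
    qed
  qed
  finally show ?thesis .
qed

lemma (in prob_space) dep_ratio_cond_indep:
  assumes X: "discrete_rv M X" and Y: "discrete_rv M Y" and Z: "discrete_rv M Z"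
    and ci: "cond_indep_rv M X Y Z"
    and a: "0 < \<P>(w in M. X w = a)" and c: "0 < \<P>(w in M. Y w = c)"
  shows "(\<integral>\<^sup>+v. ennreal (dep_ratio M Z Y (Z v) c) \<partial>uniform_measure M {w\<in>space M. X w = a}) =
    ennreal (dep_ratio M X Y a c)"
proof -
  let ?A = "{w\<in>space M. X w = a}" and ?C = "{w\<in>space M. Y w = c}"
  let ?r = "\<lambda>d. dep_ratio M Z Y d c"
  have A [measurable]: "?A \<in> events" and C [measurable]: "?C \<in> events"
    using X Y by (auto intro: discrete_rv_event)
  have [measurable]: "(\<lambda>v. ?r (Z v)) \<in> borel_measurable M"
    by (rule measurable_compose[OF discrete_rv_measurable[OF Z]]) simp
  have AC: "?A \<inter> ?C = {w\<in>space M. X w = a \<and> Y w = c}" by auto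
  have "(\<integral>\<^sup>+v. ennreal (?r (Z v)) * indicator ?A v \<partial>M) =
      (\<integral>\<^sup>+w. ennreal (?r (Z w) * prob {v\<in>?A. Z v = Z w} / \<P>(v in M. Z v = Z w)) \<partial>M)"
    by (rule nn_integral_tower_indicator[OF Z A dep_ratio_nonneg])
  also have "\<dots> = (\<integral>\<^sup>+w. ennreal (1 / prob ?C * prob {v\<in>?A \<inter> ?C. Z v = Z w} / \<P>(v in M. Z v = Z w)) \<partial>M)"
  proof (rule nn_integral_cong_AE)
    show "AE w in M. ennreal (?r (Z w) * prob {v\<in>?A. Z v = Z w} / \<P>(v in M. Z v = Z w)) =
        ennreal (1 / prob ?C * prob {v\<in>?A \<inter> ?C. Z v = Z w} / \<P>(v in M. Z v = Z w))"
      using AE_discrete_rv_pos[OF Z]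
    proof eventually_elim
      case (elim w)
      have "\<P>(v in M. X v = a \<and> Y v = c \<and> Z v = Z w) * \<P>(v in M. Z v = Z w) =
          \<P>(v in M. X v = a \<and> Z v = Z w) * \<P>(v in M. Z v = Z w \<and> Y v = c)"
        using ci unfolding cond_indep_rv_def conj_commute[of "Z _ = _" "Y _ = _"] by blast
      then have "?r (Z w) * \<P>(v in M. X v = a \<and> Z v = Z w) =
          1 / prob ?C * \<P>(v in M. X v = a \<and> Y v = c \<and> Z v = Z w)"
        using elim c by (simp add: dep_ratio_def field_simps)
      moreover have "{v\<in>?A \<inter> ?C. Z v = Z w} = {v\<in>space M. X v = a \<and> Y v = c \<and> Z v = Z w}"
        "{v\<in>?A. Z v = Z w} = {v\<in>space M. X v = a \<and> Z v = Z w}" by auto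
      ultimately show ?case by simp
    qed
  qed
  also have "\<dots> = (\<integral>\<^sup>+v. ennreal (1 / prob ?C) * indicator (?A \<inter> ?C) v \<partial>M)"
    by (rule nn_integral_tower_indicator[OF Z, of "?A \<inter> ?C" "\<lambda>_. 1 / prob ?C", symmetric]) auto
  also have "\<dots> = ennreal (1 / prob ?C * prob (?A \<inter> ?C))"
    by (subst nn_integral_cmult_indicator) (auto simp: emeasure_eq_measure ennreal_mult simp del: times_divide_eq_left)
  finally have eq: "(\<integral>\<^sup>+v. ennreal (?r (Z v)) * indicator ?A v \<partial>M) = \<dots>" .
  have "(\<integral>\<^sup>+v. ennreal (?r (Z v)) \<partial>uniform_measure M ?A) =
      (\<integral>\<^sup>+v. ennreal (?r (Z v)) * indicator ?A v \<partial>M) / prob ?A"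
    by (subst nn_integral_uniform_measure) (auto simp: emeasure_eq_measure)
  also have "\<dots> = ennreal (1 / prob ?C * prob (?A \<inter> ?C) / prob ?A)"
    unfolding eq using a by (intro divide_ennreal) auto
  finally show ?thesis by (simp add: dep_ratio_def AC mult.commute)
qed

lemma measurable_kl_fun_dep_ratio:
  assumes "discrete_rv M X" "discrete_rv M Y"
  shows "(\<lambda>p. ennreal (kl_fun (dep_ratio M X Y (X (fst p)) (Y (snd p))))) \<in> borel_measurable (M \<Otimes>\<^sub>M M)"
  by (rule measurable_compose[OF discrete_rv_measurable_pair[OF assms,
        of "\<lambda>a c. ennreal (kl_fun (dep_ratio M X Y a c))"], of "\<lambda>u. u" borel]) simp

lemma (in information_space) mutual_info_data_processing:
  assumes X: "discrete_rv M X" and Y: "discrete_rv M Y" and Z: "discrete_rv M Z"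
    and ci: "cond_indep_rv M X Y Z"
  shows "mutual_info M b X Y \<le> mutual_info M b Z Y"
proof -
  interpret MM: pair_prob_space M M ..
  let ?kX = "\<lambda>w v. ennreal (kl_fun (dep_ratio M X Y (X w) (Y v)))"
  let ?kZ = "\<lambda>w v. ennreal (kl_fun (dep_ratio M Z Y (Z w) (Y v)))"
  let ?U = "\<lambda>w. uniform_measure M {u\<in>space M. X u = X w}"
  have [measurable]: "(\<lambda>w. dep_ratio M Z Y (Z w) c) \<in> borel_measurable M" for c
    by (rule measurable_compose[OF discrete_rv_measurable[OF Z]]) simp
  have jensen: "AE v in M. AE w in M. ?kX w v \<le> (\<integral>\<^sup>+u. ?kZ u v \<partial>?U w)"
    using AE_discrete_rv_pos[OF Y]
  proof eventually_elim
    case c: (elim v)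
    show ?case
      using AE_discrete_rv_pos[OF X]
    proof eventually_elim
      case (elim w)
      interpret U: prob_space "?U w"
        using elim by (intro prob_space_uniform_measure) (auto simp: emeasure_eq_measure)
      show ?case
        by (rule U.kl_fun_jensen[OF _ dep_ratio_nonneg dep_ratio_cond_indep[OF X Y Z ci elim c]])
          (auto simp: dep_ratio_nonneg)
    qed
  qed
  have "(\<integral>\<^sup>+w. \<integral>\<^sup>+v. ?kX w v \<partial>M \<partial>M) = (\<integral>\<^sup>+v. \<integral>\<^sup>+w. ?kX w v \<partial>M \<partial>M)"
    by (rule MM.Fubini'[symmetric]) (simp add: split_beta' measurable_kl_fun_dep_ratio[OF X Y])
  also have "\<dots> \<le> (\<integral>\<^sup>+v. \<integral>\<^sup>+w. \<integral>\<^sup>+u. ?kZ u v \<partial>?U w \<partial>M \<partial>M)"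
    using jensen by (intro nn_integral_mono_AE) (auto elim!: eventually_mono intro!: nn_integral_mono_AE)
  also have "\<dots> = (\<integral>\<^sup>+v. \<integral>\<^sup>+u. ?kZ u v \<partial>M \<partial>M)"
    by (intro nn_integral_cong nn_integral_tower[OF X]) measurable
  also have "\<dots> = (\<integral>\<^sup>+u. \<integral>\<^sup>+v. ?kZ u v \<partial>M \<partial>M)"
    by (rule MM.Fubini') (simp add: split_beta' measurable_kl_fun_dep_ratio[OF Z Y])
  finally have "(\<integral>\<^sup>+w. \<integral>\<^sup>+v. ?kX w v \<partial>M \<partial>M) \<le> (\<integral>\<^sup>+w. \<integral>\<^sup>+v. ?kZ w v \<partial>M \<partial>M)" .
  then show ?thesis
    unfolding mutual_info_eq_nn_integral[OF X Y] mutual_info_eq_nn_integral[OF Z Y]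
    by (intro mult_left_mono) auto
qed

lemma cond_indep_rv_function: "cond_indep_rv M (\<lambda>w. f (Z w)) Y Z"
proof -
  have "{w\<in>space M. f (Z w) = a \<and> Y w = c \<and> Z w = d} = (if f d = a then {w\<in>space M. Y w = c \<and> Z w = d} else {})"
    "{w\<in>space M. f (Z w) = a \<and> Z w = d} = (if f d = a then {w\<in>space M. Z w = d} else {})" for a c d
    by auto
  then show ?thesis by (simp add: cond_indep_rv_def)
qed

theorem theorem4p1:
  fixes M :: "'w measure" and b :: real
    and x :: "'w \<Rightarrow> 'a" and t :: "'w \<Rightarrow> 'b" and y :: "'w \<Rightarrow> 'c"
    and z1 :: "'w \<Rightarrow> 'd" and z2 :: "'w \<Rightarrow> 'e"
  assumes "information_space M b"
    and "discrete_rv M x" and "discrete_rv M t" and "discrete_rv M y"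
    and "discrete_rv M z1" and "discrete_rv M z2"
    and "cond_mutual_info M b z1 y (\<lambda>w. (x w, t w)) = 0"
    and "cond_mutual_info M b (\<lambda>w. (x w, t w)) y z1 = 0"
    and "cond_mutual_info M b z2 y x = 0"
    and "cond_mutual_info M b x y z2 = 0"
  shows "mutual_info M b z1 y \<ge> mutual_info M b z2 y"
proof -
  interpret information_space M b by fact
  note xt = discrete_rv_Pair[OF assms(2,3)]
  have "mutual_info M b z2 y \<le> mutual_info M b x y"
    using assms by (intro mutual_info_data_processing cond_indep_if_cond_mutual_info_eq_0)
  also have "\<dots> \<le> mutual_info M b (\<lambda>w. (x w, t w)) y"
    using assms(2,4) xt cond_indep_rv_function[of M fst "\<lambda>w. (x w, t w)" y]
    by (intro mutual_info_data_processing) auto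
  also have "\<dots> \<le> mutual_info M b z1 y"
    using assms xt by (intro mutual_info_data_processing cond_indep_if_cond_mutual_info_eq_0)
  finally show ?thesis .
qed

end
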